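(* Let $m, N \in \mathbb{N}$ with $m,N\ge1$, $p \in [1, +\infty)$ and let $\mathcal{G}$ be an energy over $\mathbb{R}^m$ with state space $\mathbb{R}^N$. Assume that for every measurable map $u:\mathbb{R}^m\to\mathbb{R}^N$: (i) (superadditivity) if the sets $A,B\subset \mathbb{R}^m$ are open and if $\bar{A} \cap \bar{B} = \emptyset$, then $\mathcal{G}(u,A\cup B)\geq \mathcal{G}(u,A)+\mathcal{G}(u,B)$; (ii) (scaling) for all $\lambda>0$, $h\in\mathbb{R}^m$ and any open set $A\subset\mathbb{R}^m$, $\mathcal{G}(u ,h+\lambda A)=\lambda^{m}\, \mathcal{G}(u(h + \lambda\, \cdot),A)$. If for every $u\in L^p(\mathbb{B}^m,\mathbb{R}^N)$, $\mathcal{G}(u,\mathbb{B}^m) < + \infty$, then there exists $C \in [0, +\infty)$ such that for every $u\in L^p(\mathbb{B}^m , \mathbb{R}^N)$, one has \[ \mathcal{G}(u,\mathbb{B}^m)\le C \,\biggl(1 + \int_{\mathbb{B}^m}|u|^p \biggr). \]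
   Context: $\mathbb{B}^m$ is the (open) unit ball in $\mathbb{R}^m$. An energy over $\mathbb{R}^m$ with state space $\mathbb{R}^N$ is a map $\mathcal{G}$ that assigns to every open set $A \subset \mathbb{R}^m$ and every measurable map $u : A \to \mathbb{R}^N$ some $\mathcal{G}(u, A)\in [0, + \infty]$, such that if $A \subseteq B$ are open sets and $u: B \to \mathbb{R}^N$ is measurable, then $\mathcal{G}(u|_A,A)\leq \mathcal{G}(u,B)$. When $u:B\to\mathbb{R}^N$ is measurable and $A\subset B\subset\mathbb{R}^m$ are open, $\mathcal{G}(u,A)$ means $\mathcal{G}(u|_A,A)$. *)

theory Defs
  imports "HOL-Analysis.Analysis"
begin

text \<open>
  A map \<open>u : A \<rightarrow> \<real>\<^sup>N\<close> on a subset of \<open>\<real>\<^sup>m\<close> is represented by the total function \<open>restrict u A\<close>,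
  whose values outside of \<open>A\<close> are the fixed value \<open>undefined\<close>. Measurable means Lebesgue measurable.
\<close>

type_synonym ('m, 'n) energy_fun = "(real ^ 'm \<Rightarrow> real ^ 'n) \<Rightarrow> (real ^ 'm) set \<Rightarrow> ennreal"

definition measurable_maps :: "(real ^ 'm) set \<Rightarrow> (real ^ 'm \<Rightarrow> real ^ 'n) set" where
  "measurable_maps A = borel_measurable (lebesgue_on A) \<inter> extensional A"

text \<open>
  Only the values \<open>G u A\<close> with \<open>A\<close> open and \<open>u \<in> measurable_maps A\<close> are meaningful.
\<close>

definition energy :: "('m::finite, 'n::finite) energy_fun \<Rightarrow> bool" where
  "energy G \<longleftrightarrow>
     (\<forall>A B u. open A \<longrightarrow> open B \<longrightarrow> A \<subseteq> B \<longrightarrow> u \<in> measurable_maps B \<longrightarrow>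
        G (restrict u A) A \<le> G u B)"

definition energy_on :: "('m, 'n) energy_fun \<Rightarrow> (real ^ 'm \<Rightarrow> real ^ 'n) \<Rightarrow> (real ^ 'm) set \<Rightarrow> ennreal"
  where "energy_on G u A = G (restrict u A) A"

text \<open>
  Functions, not classes modulo equality almost everywhere: an energy need not be
  invariant under modification on null sets.
\<close>

definition Lp_maps :: "real \<Rightarrow> (real ^ 'm) set \<Rightarrow> (real ^ 'm \<Rightarrow> real ^ 'n) set" where
  "Lp_maps p A = {u \<in> measurable_maps A. integrable (lebesgue_on A) (\<lambda>x. norm (u x) powr p)}"

end

theory Submission
  imports Defs
begin

text \<open>
  If no constant works, there are maps \<open>U k\<close> whose energy exceeds \<open>D k * (1 + \<integral>|U k|\<^sup>p)\<close>, for
  \<open>D k\<close> growing as fast as we like. Place rescaled copies of them in pairwise disjoint balls of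
  radius \<open>r k\<close> inside the unit ball. Energy and \<open>p\<close>-th power integral scale by the same factor
  \<open>r k ^ m\<close>, so with \<open>r k ^ m * (1 + \<integral>|U k|\<^sup>p)\<close> summable but \<open>D k\<close> times it unbounded, the glued
  map is in \<open>L\<^sup>p\<close> while by monotonicity its energy is infinite.
\<close>

text \<open>Continuity alone gives only Borel preimages of Borel sets. For the completed
  \<sigma>-algebra on both sides, preimages of null sets must be null too, which holds because
  \<open>c \<noteq> 0\<close> makes the map invertible.\<close>

lemma affine_lebesgue_measurable:
  fixes h :: "'a::euclidean_space"
  assumes "c \<noteq> 0"
  shows "(\<lambda>x. h + c *\<^sub>R x) \<in> lebesgue \<rightarrow>\<^sub>M lebesgue"
proof -
  have "(\<lambda>x. h + (\<Sum>j\<in>Basis. (c * (x \<bullet> j)) *\<^sub>R j)) \<in> lebesgue \<rightarrow>\<^sub>M lebesgue"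
    using assms by (intro lebesgue_affine_measurable) auto
  moreover have "(\<Sum>j\<in>Basis. (c * (x \<bullet> j)) *\<^sub>R j) = c *\<^sub>R x" for x :: 'a
    by (simp add: euclidean_representation flip: scaleR_scaleR scaleR_sum_right)
  ultimately show ?thesis
    by simp
qed

text \<open>Lebesgue measure is \<open>c ^ DIM('a)\<close> times its image under the affine map.
  Integrals thus acquire the same factor as energies do under \<open>scaling\<close>.\<close>

lemma nn_integral_lebesgue_affine:
  fixes h :: "'a::euclidean_space" and f :: "'a \<Rightarrow> ennreal"
  assumes c: "0 < c" and f: "f \<in> borel_measurable lebesgue"
  shows "(\<integral>\<^sup>+x. f x \<partial>lebesgue) = ennreal (c ^ DIM('a)) * (\<integral>\<^sup>+x. f (h + c *\<^sub>R x) \<partial>lebesgue)"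
proof -
  have "(\<Sum>j\<in>Basis. (c * (x \<bullet> j)) *\<^sub>R j) = c *\<^sub>R x" for x :: 'a
    by (simp add: euclidean_representation flip: scaleR_scaleR scaleR_sum_right)
  then have eq: "lebesgue =
      density (distr lebesgue lebesgue (\<lambda>x. h + c *\<^sub>R x)) (\<lambda>_. ennreal (c ^ DIM('a)))"
    using lebesgue_affine_euclidean[of "\<lambda>_. c" h] c by simp
  have "(\<integral>\<^sup>+x. f x \<partial>lebesgue)
      = (\<integral>\<^sup>+x. f x \<partial>density (distr lebesgue lebesgue (\<lambda>x. h + c *\<^sub>R x)) (\<lambda>_. ennreal (c ^ DIM('a))))"
    using eq by simp
  also have "\<dots> = ennreal (c ^ DIM('a)) * (\<integral>\<^sup>+x. f (h + c *\<^sub>R x) \<partial>lebesgue)"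
    using f c affine_lebesgue_measurable[of c h]
    by (simp add: nn_integral_density nn_integral_distr nn_integral_cmult measurable_compose)
  finally show ?thesis .
qed

text \<open>The centre has norm \<open>(1/2) ^ k / 2\<close> and the radius is at most a quarter of
  that, so each ball lies in an annulus around the origin. Annuli of different index are
  disjoint.\<close>

lemma disjoint_dyadic_balls:
  fixes e :: "'a::real_normed_vector"
  assumes e: "norm e = 1" and r: "\<And>k. r k \<le> (1/2) ^ k / 8"
    and x: "x \<in> ball (((1/2) ^ j / 2) *\<^sub>R e) (r j)" "x \<in> ball (((1/2) ^ k / 2) *\<^sub>R e) (r k)"
  shows "j = k"
proof -
  have bounds: "3/8 * (1/2) ^ i < norm x \<and> norm x < 5/8 * (1/2) ^ i"
    if "x \<in> ball (((1/2) ^ i / 2) *\<^sub>R e) (r i)" for i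
  proof -
    have "norm (((1/2) ^ i / 2) *\<^sub>R e) = (1/2) ^ i / 2"
      using e by simp
    then show ?thesis
      using that r[of i] norm_triangle_ineq2[of "((1/2) ^ i / 2) *\<^sub>R e" x]
        norm_triangle_ineq2[of x "((1/2) ^ i / 2) *\<^sub>R e"]
      by (simp add: dist_norm norm_minus_commute)
  qed
  \<comment> \<open>Halving the outer factor 5/8 gives 5/16, which is below the inner factor 3/8: a
    later annulus lies strictly inside an earlier one.\<close>
  have not_less: "\<not> i < l" if "3/8 * (1/2) ^ i < norm x" "norm x < 5/8 * (1/2) ^ l" for i l :: nat
  proof
    assume "i < l"
    then have "(1/2::real) ^ l \<le> (1/2) ^ Suc i"
      by (intro power_decreasing) auto
    moreover have "(0::real) < (1/2) ^ i"
      by simp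
    ultimately show False
      using that unfolding power_Suc by linarith
  qed
  show ?thesis
    using not_less[of j k] not_less[of k j] bounds[OF x(1)] bounds[OF x(2)] by linarith
qed

theorem theorem5p1:
  fixes G :: "('m::finite, 'n::finite) energy_fun" and p :: real
  assumes "1 \<le> p"
    and "energy G"
    and superadditivity:
      "\<And>(u :: real ^ 'm \<Rightarrow> real ^ 'n) A B.
         \<lbrakk>u \<in> borel_measurable lebesgue; open A; open B; closure A \<inter> closure B = {}\<rbrakk>
         \<Longrightarrow> energy_on G u (A \<union> B) \<ge> energy_on G u A + energy_on G u B"
    and scaling:
      "\<And>(u :: real ^ 'm \<Rightarrow> real ^ 'n) (c::real) h A.
         \<lbrakk>u \<in> borel_measurable lebesgue; 0 < c; open A\<rbrakk>
         \<Longrightarrow> energy_on G u ((\<lambda>x. h + c *\<^sub>R x) ` A)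
             = ennreal (c ^ CARD('m)) * energy_on G (\<lambda>x. u (h + c *\<^sub>R x)) A"
    and finite_energy:
      "\<And>u. u \<in> Lp_maps p (ball 0 1) \<Longrightarrow> G u (ball 0 1) < \<infinity>"
  shows "\<exists>C::real. 0 \<le> C \<and>
           (\<forall>u \<in> Lp_maps p (ball 0 1).
              G u (ball 0 1)
                \<le> ennreal (C * (1 + (LINT x|lebesgue_on (ball 0 1). norm (u x) powr p))))"
proof (rule ccontr)
  assume no_bound: "\<not> ?thesis"
  define I :: "(real ^ 'm \<Rightarrow> real ^ 'n) \<Rightarrow> real"
    where "I u = (LINT x|lebesgue_on (ball 0 1). norm (u x) powr p)" for u
  define \<rho> :: "nat \<Rightarrow> real" where "\<rho> k = (1/2) ^ k / 8" for k
  have \<rho>_pos: "0 < \<rho> k" for k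
    by (simp add: \<rho>_def)
  \<comment> \<open>The candidate constant is \<open>k / \<rho> k ^ m\<close>. After shrinking, a
    factor \<open>\<rho> k ^ m\<close> will appear and leave energy at least
    \<open>k\<close>.\<close>
  have "\<exists>u. u \<in> Lp_maps p (ball 0 1) \<and>
      ennreal (real k / \<rho> k ^ CARD('m) * (1 + I u)) \<le> G u (ball 0 1)" for k
  proof -
    have "0 \<le> real k / \<rho> k ^ CARD('m)"
      using \<rho>_pos[of k] by simp
    then show ?thesis
      using no_bound unfolding I_def by (meson linear)
  qed
  then obtain U where U: "\<And>k. U k \<in> Lp_maps p (ball 0 1)"
    and G_U: "\<And>k. ennreal (real k / \<rho> k ^ CARD('m) * (1 + I (U k))) \<le> G (U k) (ball 0 1)"
    by metis
  have I_nonneg: "0 \<le> I u" for u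
    by (simp add: I_def)
  \<comment> \<open>The root is chosen so that \<open>r k ^ m * (1 + I (U k))\<close> is exactly
    \<open>\<rho> k ^ m\<close>, whatever the size of \<open>I (U k)\<close>. It is at least 1, so
    \<open>r k\<close> stays within the radius allowed for disjoint balls.\<close>
  define r where "r k = \<rho> k / root CARD('m) (1 + I (U k))" for k
  have root_ge: "1 \<le> root CARD('m) (1 + I (U k))" for k
    using I_nonneg[of "U k"] by (simp add: real_root_ge_1_iff)
  have r_pos: "0 < r k" for k
    using root_ge[of k] \<rho>_pos[of k] by (simp add: r_def)
  have r_le: "r k \<le> \<rho> k" for k
    using root_ge[of k] \<rho>_pos[of k] by (simp add: r_def divide_le_eq mult_left_le)
  have r_power: "r k ^ CARD('m) * (1 + I (U k)) = \<rho> k ^ CARD('m)" for k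
    using I_nonneg[of "U k"] by (simp add: r_def power_divide)

  define e :: "real ^ 'm" where "e = (SOME b. b \<in> Basis)"
  have norm_e: "norm e = 1"
    unfolding e_def by (simp add: some_in_eq)
  define h where "h k = ((1/2::real) ^ k / 2) *\<^sub>R e" for k :: nat
  have image_ball: "(\<lambda>x. h k + r k *\<^sub>R x) ` ball 0 1 = ball (h k) (r k)" for k
  proof -
    have "(\<lambda>x. h k + r k *\<^sub>R x) ` ball 0 1 = (+) (h k) ` (*\<^sub>R) (r k) ` ball 0 1"
      by (simp only: image_image)
    also have "(*\<^sub>R) (r k) ` ball (0 :: real ^ 'm) 1 = ball 0 (r k)"
      using r_pos[of k] by (subst ball_scale) auto
    finally show ?thesis
      by simp
  qed
  have disjoint: "j = k" if "x \<in> ball (h j) (r j)" "x \<in> ball (h k) (r k)" for j k x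
    using disjoint_dyadic_balls[OF norm_e, of r x j k] that r_le by (simp add: h_def \<rho>_def)
  have ball_sub: "ball (h k) (r k) \<subseteq> ball 0 1" for k
  proof -
    have "(1/2::real) ^ k \<le> 1"
      by (simp add: power_le_one)
    then have "dist (h k) 0 + r k \<le> 1"
      using r_le[of k] norm_e by (simp add: h_def \<rho>_def)
    then show ?thesis
      by (simp add: ball_subset_ball_iff)
  qed

  \<comment> \<open>Outside the unit ball \<open>U k\<close> is \<open>undefined\<close>; extending
    by 0 instead makes the integral over the whole space equal to \<open>I (U k)\<close>.\<close>
  define W :: "nat \<Rightarrow> real ^ 'm \<Rightarrow> real ^ 'n"
    where "W k x = (if x \<in> ball 0 1 then U k x else 0)" for k x
  have W_meas: "W k \<in> borel_measurable lebesgue" for k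
    using U[of k] unfolding W_def
    by (subst borel_measurable_if) (auto simp: Lp_maps_def measurable_maps_def)
  have W_int: "(\<integral>\<^sup>+x. ennreal (norm (W k x) powr p) \<partial>lebesgue) = ennreal (I (U k))" for k
  proof -
    have "(\<integral>\<^sup>+x. ennreal (norm (W k x) powr p) \<partial>lebesgue)
        = (\<integral>\<^sup>+x. ennreal (norm (U k x) powr p) * indicator (ball 0 1) x \<partial>lebesgue)"
      by (intro nn_integral_cong) (simp add: W_def indicator_def)
    also have "\<dots> = (\<integral>\<^sup>+x. ennreal (norm (U k x) powr p) \<partial>lebesgue_on (ball 0 1))"
      by (subst nn_integral_restrict_space) auto
    also have "\<dots> = ennreal (I (U k))"
      unfolding I_def using U[of k] by (intro nn_integral_eq_integral) (auto simp: Lp_maps_def)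
    finally show ?thesis .
  qed
  \<comment> \<open>The copy of \<open>U k\<close> transported to \<open>ball (h k) (r k)\<close>;
    it is 0 outside that ball.\<close>
  define V where "V k x = W k ((1 / r k) *\<^sub>R (x - h k))" for k x
  have V_affine: "V k (h k + r k *\<^sub>R x) = W k x" for k x
    using r_pos[of k] by (simp add: V_def)
  have V_meas [measurable]: "V k \<in> borel_measurable lebesgue" for k
  proof -
    have "V k = (\<lambda>x. W k (- (1 / r k) *\<^sub>R h k + (1 / r k) *\<^sub>R x))"
      by (simp add: V_def scaleR_diff_right fun_eq_iff)
    moreover have "(\<lambda>x. - (1 / r k) *\<^sub>R h k + (1 / r k) *\<^sub>R x) \<in> lebesgue \<rightarrow>\<^sub>M lebesgue"
      using r_pos[of k] by (intro affine_lebesgue_measurable) simp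
    ultimately show ?thesis
      using measurable_compose[OF _ W_meas[of k]] by simp
  qed
  have V_int: "(\<integral>\<^sup>+x. ennreal (norm (V k x) powr p) \<partial>lebesgue) \<le> ennreal ((1/2) ^ k)" for k
  proof -
    have "(\<integral>\<^sup>+x. ennreal (norm (V k x) powr p) \<partial>lebesgue)
        = ennreal (r k ^ CARD('m)) * ennreal (I (U k))"
      using r_pos[of k]
      by (subst nn_integral_lebesgue_affine[where c = "r k" and h = "h k"]) (auto simp: V_affine W_int)
    also have "\<dots> = ennreal (r k ^ CARD('m) * I (U k))"
      using r_pos[of k] I_nonneg by (simp add: ennreal_mult)
    \<comment> \<open>Here \<open>I (U k)\<close> is enlarged to \<open>1 + I (U k)\<close>. The
      next bound uses \<open>m \<ge> 1\<close>: since \<open>\<rho> k \<le> 1\<close>, its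
      \<open>m\<close>-th power is at most \<open>\<rho> k\<close>, which gives a geometric
      series.\<close>
    also have "\<dots> \<le> ennreal (\<rho> k ^ CARD('m))"
      using r_pos[of k] by (intro ennreal_leI) (simp add: mult_left_mono flip: r_power)
    also have "\<dots> \<le> ennreal ((1/2) ^ k)"
    proof (intro ennreal_leI)
      have "\<rho> k \<le> (1/2) ^ k" "\<rho> k \<le> 1"
        using power_le_one[of "1/2::real" k] by (auto simp: \<rho>_def)
      then show "\<rho> k ^ CARD('m) \<le> (1/2) ^ k"
        using power_decreasing[of 1 "CARD('m)" "\<rho> k"] \<rho>_pos[of k] by (simp add: Suc_leI)
    qed
    finally show ?thesis .
  qed

  \<comment> \<open>The index of the ball containing \<open>x\<close>. Off all balls the value of
    \<open>LEAST\<close> is unspecified but harmless, since every \<open>V k\<close> vanishes there,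
    and so does the glued map \<open>u\<close>.\<close>
  define K where "K x = (LEAST k. x \<in> ball (h k) (r k))" for x
  have K_eq: "K x = k" if "x \<in> ball (h k) (r k)" for x k
    using disjoint that unfolding K_def by (metis (no_types, lifting) LeastI)
  have K_meas [measurable]: "K \<in> lebesgue \<rightarrow>\<^sub>M count_space UNIV"
    unfolding K_def by (intro measurable_Least) (simp add: pred_def del: mem_ball)
  define u where "u x = V (K x) x" for x
  have u_meas [measurable]: "u \<in> borel_measurable lebesgue"
    unfolding u_def by (rule measurable_compose_countable[OF _ K_meas]) measurable
  \<comment> \<open>Equality must hold at every point, since energies may see null sets. Outside the
    unit ball both sides are \<open>undefined\<close>, as \<open>U k\<close> is extensional.\<close>
  have u_affine: "restrict (\<lambda>x. u (h k + r k *\<^sub>R x)) (ball 0 1) = U k" for k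
  proof
    fix x
    show "restrict (\<lambda>x. u (h k + r k *\<^sub>R x)) (ball 0 1) x = U k x"
    proof (cases "x \<in> ball 0 1")
      case True
      then have "h k + r k *\<^sub>R x \<in> ball (h k) (r k)"
        using image_ball[of k] by blast
      then show ?thesis
        using True K_eq by (simp add: u_def V_affine W_def)
    next
      case False
      then show ?thesis
        using U[of k] by (auto simp: Lp_maps_def measurable_maps_def extensional_def)
    qed
  qed
  have u_int: "(\<integral>\<^sup>+x. ennreal (norm (u x) powr p) \<partial>lebesgue) < \<infinity>"
  proof -
    have "(\<integral>\<^sup>+x. ennreal (norm (u x) powr p) \<partial>lebesgue)
        \<le> (\<integral>\<^sup>+x. (\<Sum>k. ennreal (norm (V k x) powr p)) \<partial>lebesgue)"
    proof (intro nn_integral_mono)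
      fix x
      \<comment> \<open>At each point \<open>u\<close> agrees with one of the \<open>V k\<close>, so
        the series dominates it through that single term.\<close>
      have "(\<Sum>k\<in>{K x}. ennreal (norm (V k x) powr p)) \<le> (\<Sum>k. ennreal (norm (V k x) powr p))"
        by (intro sum_le_suminf) auto
      then show "ennreal (norm (u x) powr p) \<le> (\<Sum>k. ennreal (norm (V k x) powr p))"
        by (simp add: u_def)
    qed
    also have "\<dots> = (\<Sum>k. \<integral>\<^sup>+x. ennreal (norm (V k x) powr p) \<partial>lebesgue)"
      by (intro nn_integral_suminf) measurable
    also have "\<dots> \<le> (\<Sum>k. ennreal ((1/2) ^ k))"
      by (intro suminf_le V_int) auto
    also have "\<dots> = ennreal (\<Sum>k. (1/2) ^ k)"
      by (intro suminf_ennreal2) (auto simp: summable_geometric)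
    also have "\<dots> < \<infinity>"
      by simp
    finally show ?thesis .
  qed

  have u_maps: "restrict u (ball 0 1) \<in> measurable_maps (ball 0 1)"
  proof -
    have "u \<in> borel_measurable (lebesgue_on (ball 0 1))"
      using u_meas by (rule measurable_restrict_space1)
    then have "restrict u (ball 0 1) \<in> borel_measurable (lebesgue_on (ball 0 1))"
      by (rule measurable_cong[THEN iffD1, rotated]) (simp add: space_restrict_space)
    then show ?thesis
      by (simp add: measurable_maps_def)
  qed
  have u_Lp: "restrict u (ball 0 1) \<in> Lp_maps p (ball 0 1)"
  proof -
    have "integrable lebesgue (\<lambda>x. norm (u x) powr p)"
      using u_int by (intro integrableI_bounded) auto
    then have "integrable lebesgue (\<lambda>x. indicator (ball 0 1) x *\<^sub>R (norm (u x) powr p))"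
      by (rule integrable_mult_indicator[rotated]) simp
    also have "(\<lambda>x. indicator (ball 0 1) x *\<^sub>R (norm (u x) powr p))
        = (\<lambda>x. indicator (ball 0 1) x *\<^sub>R (norm (restrict u (ball 0 1) x) powr p))"
      by (simp add: fun_eq_iff indicator_def)
    finally have "integrable (lebesgue_on (ball 0 1)) (\<lambda>x. norm (restrict u (ball 0 1) x) powr p)"
      by (subst integrable_restrict_space) simp_all
    then show ?thesis
      using u_maps by (simp add: Lp_maps_def)
  qed
  \<comment> \<open>By \<open>scaling\<close>, the energy of \<open>u\<close> on the
    \<open>k\<close>-th ball is \<open>r k ^ m\<close> times that of \<open>U k\<close>, hence at
    least \<open>k\<close>; monotonicity passes this to the unit ball, for every
    \<open>k\<close>.\<close>
  have "of_nat k \<le> G (restrict u (ball 0 1)) (ball 0 1)" for k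
  proof -
    have "ennreal (real k) = ennreal (r k ^ CARD('m) * (real k / \<rho> k ^ CARD('m) * (1 + I (U k))))"
    proof -
      have "r k ^ CARD('m) * (real k / \<rho> k ^ CARD('m) * (1 + I (U k)))
          = (r k ^ CARD('m) * (1 + I (U k))) * real k / \<rho> k ^ CARD('m)"
        by simp
      then show ?thesis
        unfolding r_power using \<rho>_pos[of k] by simp
    qed
    also have "\<dots> \<le> ennreal (r k ^ CARD('m)) * G (U k) (ball 0 1)"
      using r_pos[of k] mult_left_mono[OF G_U[of k], of "ennreal (r k ^ CARD('m))"]
      by (subst ennreal_mult') auto
    also have "\<dots> = energy_on G u (ball (h k) (r k))"
      using scaling[OF u_meas r_pos[of k] open_ball, of "h k" 0 1]
      by (simp add: image_ball energy_on_def u_affine)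
    also have "\<dots> \<le> G (restrict u (ball 0 1)) (ball 0 1)"
    proof -
      have "restrict (restrict u (ball 0 1)) (ball (h k) (r k)) = restrict u (ball (h k) (r k))"
        using ball_sub[of k] by (simp add: Int_absorb1 del: restrict_apply)
      then show ?thesis
        using \<open>energy G\<close> u_maps ball_sub[of k] unfolding energy_def energy_on_def
        by (metis open_ball)
    qed
    finally show ?thesis
      by (simp add: ennreal_of_nat_eq_real_of_nat)
  qed
  then have "G (restrict u (ball 0 1)) (ball 0 1) = \<infinity>"
    using ennreal_Ex_less_of_nat by (metis infinity_ennreal_def leD top.not_eq_extremum)
  then show False
    using finite_energy[OF u_Lp] by simp
qed

end
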